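(* Let $\mathcal{G}_{net}$ be a connected undirected network (all links bidirectional) on $m$ sensors $y_1,\dots,y_m$, with symmetric positive link costs $b_{ij}=b_{ji}$. Consider the networking cost optimization problem $$\min_{\mathcal{W}\in\{0,1\}^{m\times m}}\ \sum_{i=1}^m\sum_{j=1}^m b_{ij}\mathcal{W}_{ij}\quad\text{s.t. }\mathcal{G}_W\subset\mathcal{G}_{net},\quad \mathcal{G}_W\text{ is strongly connected and spans all } m \text{ sensors},$$ where communication is mutual, i.e. $\mathcal{W}_{ij}=\mathcal{W}_{ji}$ for all $i,j$. Then this problem is equivalent to the minimum-weight spanning tree problem on $\mathcal{G}_{net}$ with edge weights $b_{ij}$, and an exact optimal solution can be computed in $\mathcal{O}(m^2)$ operations given the (weighted) adjacency matrix of $\mathcal{G}_{net}$.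
   Context: $\mathcal{G}_{net}$ represents all possible communication links among the sensors, and $b_{ij}$ is the cost of the communication link from sensor $y_i$ to sensor $y_j$. $\mathcal{G}_W$ is the communication network actually selected; its structure is encoded by the 0-1 matrix $\mathcal{W}$, where $\mathcal{W}_{ij}=1$ means that the link from $y_i$ to $y_j$ is used (which is only allowed if this link is in $\mathcal{G}_{net}$). Mutual sharing means that sensor $i$ shares its information with sensor $j$ if and only if sensor $j$ shares its information with sensor $i$. A digraph is strongly connected if there is a directed path from every node to every other node. *)

theory Defs
  imports
    "Graph_Theory.Graph_Theory"
    "Jordan_Normal_Form.Matrix"
    "HOL-Library.Landau_Symbols"
begin

section \<open>The networking cost problem\<close>

text \<open>
  Sensors are the numbers \<open>0, \<dots>, m - 1\<close>. Self-links are not excluded from the available network.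
  Only the costs of available links matter; \<open>b\<close> is unconstrained elsewhere.
  \<open>Digraph_Component.connected\<close> includes that the network is nonempty, hence \<open>m \<ge> 1\<close>.
\<close>

definition sensor_network ::
  "nat \<Rightarrow> nat pair_pre_digraph \<Rightarrow> (nat \<Rightarrow> nat \<Rightarrow> real) \<Rightarrow> bool" where
  "sensor_network m Gnet b \<longleftrightarrow>
     pair_pseudo_graph Gnet \<and> pverts Gnet = {..<m} \<and>
     Digraph_Component.connected (with_proj Gnet) \<and>
     (\<forall>(i, j) \<in> parcs Gnet. b i j = b j i \<and> 0 < b i j)"

definition network_of :: "real mat \<Rightarrow> nat pair_pre_digraph" where
  "network_of W =
     \<lparr> pverts = {..<dim_row W},
       parcs = {(i, j). i < dim_row W \<and> j < dim_col W \<and> W $$ (i, j) = 1} \<rparr>"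

definition feasible :: "nat \<Rightarrow> nat pair_pre_digraph \<Rightarrow> real mat \<Rightarrow> bool" where
  "feasible m Gnet W \<longleftrightarrow>
     W \<in> carrier_mat m m \<and> elements_mat W \<subseteq> {0, 1} \<and>
     (\<forall>i<m. \<forall>j<m. W $$ (i, j) = W $$ (j, i)) \<and>
     spanning (with_proj (network_of W)) (with_proj Gnet) \<and>
     strongly_connected (with_proj (network_of W))"

definition network_cost :: "nat \<Rightarrow> (nat \<Rightarrow> nat \<Rightarrow> real) \<Rightarrow> real mat \<Rightarrow> real" where
  "network_cost m b W = (\<Sum>i<m. \<Sum>j<m. b i j * W $$ (i, j))"

definition optimal_network ::
  "nat \<Rightarrow> nat pair_pre_digraph \<Rightarrow> (nat \<Rightarrow> nat \<Rightarrow> real) \<Rightarrow> real mat \<Rightarrow> bool" where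
  "optimal_network m Gnet b W \<longleftrightarrow> is_arg_min (network_cost m b) (feasible m Gnet) W"


section \<open>Minimum-weight spanning trees\<close>

text \<open>
  \<open>Digraph_Component.spanning_tree\<close> only forbids directed cycles, so it is not the notion for
  undirected graphs: the two opposite arcs of a link form a directed cycle, and an acyclically
  oriented triangle is a tree there. A spanning tree is therefore given by a set of
  undirected edges, and a cycle must not traverse an undirected edge twice (in either direction).
  A loop \<open>{v}\<close> is a cycle.
\<close>

definition undirected_edges :: "'a pair_pre_digraph \<Rightarrow> 'a set set" where
  "undirected_edges G = (\<lambda>(u, v). {u, v}) ` parcs G"

definition graph_of_edges :: "'a set \<Rightarrow> 'a set set \<Rightarrow> 'a pair_pre_digraph" where
  "graph_of_edges V T = \<lparr> pverts = V, parcs = {(u, v). {u, v} \<in> T} \<rparr>"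

definition undirected_cycle :: "'a pair_pre_digraph \<Rightarrow> ('a \<times> 'a) awalk \<Rightarrow> bool" where
  "undirected_cycle G p \<longleftrightarrow>
     pre_digraph.cycle (with_proj G) p \<and> distinct (map (\<lambda>(u, v). {u, v}) p)"

definition undirected_spanning_tree :: "'a pair_pre_digraph \<Rightarrow> 'a set set \<Rightarrow> bool" where
  "undirected_spanning_tree G T \<longleftrightarrow>
     T \<subseteq> undirected_edges G \<and>
     Digraph_Component.connected (with_proj (graph_of_edges (pverts G) T)) \<and>
     \<not> (\<exists>p. undirected_cycle (graph_of_edges (pverts G) T) p)"

text \<open>For \<open>e = {i, j}\<close> the summand is \<open>b i j\<close> or \<open>b j i\<close>, which agree for links.\<close>

definition edges_weight :: "(nat \<Rightarrow> nat \<Rightarrow> real) \<Rightarrow> nat set set \<Rightarrow> real" where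
  "edges_weight b T = (\<Sum>e\<in>T. b (Min e) (Max e))"

definition min_spanning_tree ::
  "nat pair_pre_digraph \<Rightarrow> (nat \<Rightarrow> nat \<Rightarrow> real) \<Rightarrow> nat set set \<Rightarrow> bool" where
  "min_spanning_tree G b T \<longleftrightarrow> is_arg_min (edges_weight b) (undirected_spanning_tree G) T"

definition adjacency_mat :: "nat \<Rightarrow> nat set set \<Rightarrow> real mat" where
  "adjacency_mat m T = mat m m (\<lambda>(i, j). if {i, j} \<in> T then 1 else 0)"

text \<open>Costs of links are positive, so an entry is \<open>0\<close> exactly if there is no link.\<close>

definition weighted_adjacency_mat ::
  "nat \<Rightarrow> nat pair_pre_digraph \<Rightarrow> (nat \<Rightarrow> nat \<Rightarrow> real) \<Rightarrow> real mat" where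
  "weighted_adjacency_mat m Gnet b =
     mat m m (\<lambda>(i, j). if (i, j) \<in> parcs Gnet then b i j else 0)"


section \<open>Counting operations: a random access machine with exact reals\<close>

text \<open>
  Programs work on natural number variables, one-dimensional arrays of natural numbers and
  two-dimensional arrays of reals. Each operator, constant, memory read, assignment and test costs
  one unit. The operations are deliberately few (no multiplication, division or rounding): a machine
  with more of them can run these programs at the same cost. Constants are natural numbers, so a
  program is a finite object.
\<close>

type_synonym vname = string

record memory =
  nvar :: "vname \<Rightarrow> nat"
  narr :: "vname \<Rightarrow> nat \<Rightarrow> nat"
  rarr :: "vname \<Rightarrow> nat \<Rightarrow> nat \<Rightarrow> real"

datatype nexp =
    NConst nat
  | NVar vname
  | NArr vname nexp
  | NAdd nexp nexp
  | NSub nexp nexp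

datatype rexp =
    RConst nat
  | RArr vname nexp nexp
  | RAdd rexp rexp
  | RSub rexp rexp

datatype bexp =
    NLess nexp nexp
  | RLess rexp rexp
  | BNot bexp
  | BAnd bexp bexp

datatype com =
    Skip
  | SetNVar vname nexp
  | SetNArr vname nexp nexp
  | SetRArr vname nexp nexp rexp
  | Seq com com
  | Cond bexp com com
  | While bexp com

primrec nval :: "nexp \<Rightarrow> memory \<Rightarrow> nat" where
  "nval (NConst k) s = k"
| "nval (NVar x) s = nvar s x"
| "nval (NArr x e) s = narr s x (nval e s)"
| "nval (NAdd e f) s = nval e s + nval f s"
| "nval (NSub e f) s = nval e s - nval f s"

primrec ncost :: "nexp \<Rightarrow> nat" where
  "ncost (NConst k) = 1"
| "ncost (NVar x) = 1"
| "ncost (NArr x e) = ncost e + 1"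
| "ncost (NAdd e f) = ncost e + ncost f + 1"
| "ncost (NSub e f) = ncost e + ncost f + 1"

primrec rval :: "rexp \<Rightarrow> memory \<Rightarrow> real" where
  "rval (RConst k) s = real k"
| "rval (RArr x e f) s = rarr s x (nval e s) (nval f s)"
| "rval (RAdd r q) s = rval r s + rval q s"
| "rval (RSub r q) s = rval r s - rval q s"

primrec rcost :: "rexp \<Rightarrow> nat" where
  "rcost (RConst k) = 1"
| "rcost (RArr x e f) = ncost e + ncost f + 1"
| "rcost (RAdd r q) = rcost r + rcost q + 1"
| "rcost (RSub r q) = rcost r + rcost q + 1"

primrec bval :: "bexp \<Rightarrow> memory \<Rightarrow> bool" where
  "bval (NLess e f) s = (nval e s < nval f s)"
| "bval (RLess r q) s = (rval r s < rval q s)"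
| "bval (BNot c) s = (\<not> bval c s)"
| "bval (BAnd c d) s = (bval c s \<and> bval d s)"

primrec bcost :: "bexp \<Rightarrow> nat" where
  "bcost (NLess e f) = ncost e + ncost f + 1"
| "bcost (RLess r q) = rcost r + rcost q + 1"
| "bcost (BNot c) = bcost c + 1"
| "bcost (BAnd c d) = bcost c + bcost d + 1"

text \<open>\<open>exec p s t s'\<close>: started in \<open>s\<close>, the program \<open>p\<close> halts in \<open>s'\<close> after \<open>t\<close> operations.\<close>

inductive exec :: "com \<Rightarrow> memory \<Rightarrow> nat \<Rightarrow> memory \<Rightarrow> bool" where
  exec_Skip: "exec Skip s 1 s"
| exec_SetNVar:
    "exec (SetNVar x e) s (ncost e + 1) (s\<lparr>nvar := (nvar s)(x := nval e s)\<rparr>)"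
| exec_SetNArr:
    "exec (SetNArr x i e) s (ncost i + ncost e + 1)
       (s\<lparr>narr := (narr s)(x := (narr s x)(nval i s := nval e s))\<rparr>)"
| exec_SetRArr:
    "exec (SetRArr x i j r) s (ncost i + ncost j + rcost r + 1)
       (s\<lparr>rarr := (rarr s)(x := (rarr s x)(nval i s :=
          (rarr s x (nval i s))(nval j s := rval r s)))\<rparr>)"
| exec_Seq:
    "exec p s t s' \<Longrightarrow> exec q s' t' s'' \<Longrightarrow> exec (Seq p q) s (t + t') s''"
| exec_CondTrue:
    "bval c s \<Longrightarrow> exec p s t s' \<Longrightarrow> exec (Cond c p q) s (bcost c + t + 1) s'"
| exec_CondFalse:
    "\<not> bval c s \<Longrightarrow> exec q s t s' \<Longrightarrow> exec (Cond c p q) s (bcost c + t + 1) s'"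
| exec_WhileFalse:
    "\<not> bval c s \<Longrightarrow> exec (While c p) s (bcost c + 1) s"
| exec_WhileTrue:
    "bval c s \<Longrightarrow> exec p s t s' \<Longrightarrow> exec (While c p) s' t' s'' \<Longrightarrow>
     exec (While c p) s (bcost c + t + t' + 1) s''"

inductive_cases exec_SkipE: "exec Skip s t s'"
inductive_cases exec_SetNVarE: "exec (SetNVar x e) s t s'"
inductive_cases exec_SetNArrE: "exec (SetNArr x i e) s t s'"
inductive_cases exec_SetRArrE: "exec (SetRArr x i j r) s t s'"
inductive_cases exec_SeqE: "exec (Seq p q) s t s'"
inductive_cases exec_CondE: "exec (Cond c p q) s t s'"
inductive_cases exec_WhileE: "exec (While c p) s t s'"

lemma exec_deterministic:
  "exec p s t s' \<Longrightarrow> exec p s u s'' \<Longrightarrow> t = u \<and> s' = s''"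
proof (induction arbitrary: u s'' rule: exec.induct)
  case (exec_Seq p s t s' q t' s1)
  from exec_Seq.prems show ?case
    by (rule exec_SeqE) (auto dest!: exec_Seq.IH)
next
  case (exec_CondTrue c s p t s' q)
  from exec_CondTrue.prems show ?case
    by (rule exec_CondE) (auto simp: exec_CondTrue.hyps(1) dest!: exec_CondTrue.IH)
next
  case (exec_CondFalse c s q t s' p)
  from exec_CondFalse.prems show ?case
    by (rule exec_CondE) (auto simp: exec_CondFalse.hyps(1) dest!: exec_CondFalse.IH)
next
  case (exec_WhileFalse c s p)
  from exec_WhileFalse.prems show ?case
    by (rule exec_WhileE) (simp_all add: exec_WhileFalse.hyps)
next
  case (exec_WhileTrue c s p t s' t' s1)
  from exec_WhileTrue.prems show ?case
    by (rule exec_WhileE) (auto simp: exec_WhileTrue.hyps(1) dest!: exec_WhileTrue.IH)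
qed (erule exec_SkipE exec_SetNVarE exec_SetNArrE exec_SetRArrE, simp)+

text \<open>
  The input is the size in variable \<open>m\<close> and the matrix in array \<open>A\<close>; the rest of the memory may
  contain anything. The output is read from array \<open>W\<close>.
\<close>

definition holds_input :: "nat \<Rightarrow> real mat \<Rightarrow> memory \<Rightarrow> bool" where
  "holds_input m A s \<longleftrightarrow>
     nvar s ''m'' = m \<and> (\<forall>i<m. \<forall>j<m. rarr s ''A'' i j = A $$ (i, j))"

definition output_mat :: "nat \<Rightarrow> memory \<Rightarrow> real mat" where
  "output_mat m s = mat m m (\<lambda>(i, j). rarr s ''W'' i j)"

end

theory Submission
  imports Defs
begin

text \<open>
  A symmetric 0-1 matrix is the same thing as a set of links, and each link that is not a loop is
  counted twice by the network cost. A feasible set of links contains a spanning tree, and dropping a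
  link strictly lowers the cost, so the optimal networks are exactly the spanning trees of minimum
  weight. Since costs are positive, these are also the connecting sets of links of minimum weight,
  whether trees or not. This makes the exchange argument behind Prim's algorithm independent of
  cycles: a cheapest link that leaves the visited sensors may replace some crossing link of a lightest
  connecting set. Prim's algorithm, storing for each unvisited sensor its nearest visited one, needs
  two passes over the sensors per selected link, hence quadratic time.
\<close>

section \<open>Connecting sets of links\<close>

text \<open>Walks and cycles enter only where this is proved; everything after it concerns
  reachability when one link is added or removed. Loops are the obstacle in comparing costs. A loop
  is counted once by the network cost, so the cost is twice the weight on trees but not on every
  feasible set of links, and an arbitrary competitor has to be thinned to a tree before weights are
  compared. The greedy invariant fixes no optimum in advance: the selected links lie in some
  lightest connecting set, which each exchange may replace by another one. Ties between costs
  therefore need no special treatment.\<close>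

definition link_rel :: "'a set set \<Rightarrow> 'a rel" where
  "link_rel T = {(u, v). {u, v} \<in> T}"

text \<open>Paths are not confined to \<open>V\<close> here; the translation to digraphs adds
  \<open>\<Union>T \<subseteq> V\<close> and \<open>V \<noteq> {}\<close>.\<close>

definition connects :: "'a set \<Rightarrow> 'a set set \<Rightarrow> bool" where
  "connects V T \<longleftrightarrow> (\<forall>u\<in>V. \<forall>v\<in>V. (u, v) \<in> (link_rel T)\<^sup>*)"

lemma sym_link_rel: "sym (link_rel T)"
  by (auto simp: link_rel_def sym_def insert_commute)

lemma link_rel_rtrancl_sym: "(x, y) \<in> (link_rel T)\<^sup>* \<Longrightarrow> (y, x) \<in> (link_rel T)\<^sup>*"
  using sym_link_rel sym_rtrancl symE by metis

lemma link_rel_rtrancl_mono: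
  "(x, y) \<in> (link_rel T)\<^sup>* \<Longrightarrow> T \<subseteq> T' \<Longrightarrow> (x, y) \<in> (link_rel T')\<^sup>*"
  by (erule rev_subsetD, rule rtrancl_mono) (auto simp: link_rel_def)

lemma connects_mono: "connects V T \<Longrightarrow> T \<subseteq> T' \<Longrightarrow> connects V T'"
  by (auto simp: connects_def intro: link_rel_rtrancl_mono)

lemma link_rel_insert:
  "link_rel (insert {a, b} T) = insert (a, b) (insert (b, a) (link_rel T))"
  by (auto simp: link_rel_def doubleton_eq_iff)

text \<open>Repeated traversals collapse: crossing the new link and later crossing back returns to
  an endpoint that was already reachable without it. What remains is at most one crossing, in one of
  the two directions.\<close>

lemma link_rel_insert_cases:
  assumes "(x, y) \<in> (link_rel (insert {a, b} T))\<^sup>*"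
  shows "(x, y) \<in> (link_rel T)\<^sup>* \<or>
    (x, a) \<in> (link_rel T)\<^sup>* \<and> (b, y) \<in> (link_rel T)\<^sup>* \<or>
    (x, b) \<in> (link_rel T)\<^sup>* \<and> (a, y) \<in> (link_rel T)\<^sup>*"
  using assms
proof (induction rule: rtrancl_induct)
  case base
  then show ?case by simp
next
  case (step y z)
  then show ?case
    unfolding link_rel_insert by (auto intro: rtrancl_into_rtrancl rtrancl_trans)
qed

text \<open>Each passage over the link is replaced by the detour inside \<open>T\<close>. For
  \<open>a = b\<close> the detour is empty, so loops are covered as well.\<close>

lemma connects_redundant:
  assumes "connects V (insert {a, b} T)" "(a, b) \<in> (link_rel T)\<^sup>*"
  shows "connects V T"
proof -
  have "(b, a) \<in> (link_rel T)\<^sup>*" using assms(2) by (rule link_rel_rtrancl_sym)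
  then show ?thesis
    using assms unfolding connects_def by (meson link_rel_insert_cases rtrancl_trans)
qed

lemma rtrancl_crosses:
  assumes "(u, v) \<in> r\<^sup>*" "u \<in> S" "v \<notin> S"
  shows "\<exists>a b. (a, b) \<in> r \<and> a \<in> S \<and> b \<notin> S"
  using assms by (induction rule: rtrancl_induct) auto

text \<open>Elements are dropped one at a time while \<open>P\<close> survives. It yields spanning
  trees inside connecting sets as well as minimal sets of links that join two given sensors.\<close>

lemma ex_minimal_subset:
  assumes "finite T" "P T"
  shows "\<exists>T'\<subseteq>T. P T' \<and> (\<forall>f\<in>T'. \<not> P (T' - {f}))"
  using assms
proof (induction T rule: finite_psubset_induct)
  case (psubset T)
  show ?case
  proof (cases "\<forall>f\<in>T. \<not> P (T - {f})")
    case True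
    then show ?thesis using psubset.prems by blast
  next
    case False
    then obtain f where f: "f \<in> T" "P (T - {f})" by blast
    then have "T - {f} \<subset> T" by blast
    from psubset.IH[OF this f(2)] show ?thesis by blast
  qed
qed

text \<open>
  The exchanged link \<open>{a, b}\<close> has to separate \<open>u\<close> from \<open>v\<close>; a crossing link of a minimal set
  that joins \<open>u\<close> to \<open>v\<close> does.
\<close>

lemma connects_exchange:
  assumes "finite T" "connects V T" "u \<in> V" "v \<in> V" "u \<in> S" "v \<notin> S"
  obtains a b where "{a, b} \<in> T" "a \<in> S" "b \<notin> S" "connects V (insert {u, v} (T - {{a, b}}))"
proof -
  have "(u, v) \<in> (link_rel T)\<^sup>*" using assms by (auto simp: connects_def)
  with ex_minimal_subset[OF assms(1), of "\<lambda>T. (u, v) \<in> (link_rel T)\<^sup>*"]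
  obtain P where P: "P \<subseteq> T" "(u, v) \<in> (link_rel P)\<^sup>*"
    and min: "\<And>f. f \<in> P \<Longrightarrow> (u, v) \<notin> (link_rel (P - {f}))\<^sup>*" by blast
  from rtrancl_crosses[OF P(2) assms(5,6)]
  obtain a b where ab: "{a, b} \<in> P" "a \<in> S" "b \<notin> S" by (auto simp: link_rel_def)
  let ?T = "T - {{a, b}}"
  have "insert {a, b} (P - {{a, b}}) = P" using ab by blast
  with link_rel_insert_cases[of u v a b "P - {{a, b}}"] P(2) min[OF ab(1)]
  have "(u, a) \<in> (link_rel (P - {{a, b}}))\<^sup>* \<and> (b, v) \<in> (link_rel (P - {{a, b}}))\<^sup>* \<or>
    (u, b) \<in> (link_rel (P - {{a, b}}))\<^sup>* \<and> (a, v) \<in> (link_rel (P - {{a, b}}))\<^sup>*" by auto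
  then have *: "(u, a) \<in> (link_rel ?T)\<^sup>* \<and> (b, v) \<in> (link_rel ?T)\<^sup>* \<or>
    (u, b) \<in> (link_rel ?T)\<^sup>* \<and> (a, v) \<in> (link_rel ?T)\<^sup>*"
    using P(1) by (meson Diff_mono link_rel_rtrancl_mono order_refl)
  let ?R = "(link_rel (insert {u, v} ?T))\<^sup>*"
  have "(u, v) \<in> ?R" "(v, u) \<in> ?R" by (auto simp: link_rel_insert)
  moreover have lift: "(x, y) \<in> ?R" if "(x, y) \<in> (link_rel ?T)\<^sup>*" for x y
    using that by (rule link_rel_rtrancl_mono) blast
  \<comment> \<open>The way around uses the new link: a, u, v, b in the one case and a, v, u, b in
    the other.\<close>
  ultimately have "(a, b) \<in> ?R"
    using * by (meson link_rel_rtrancl_sym rtrancl_trans)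
  moreover have "connects V (insert {a, b} (insert {u, v} ?T))"
    by (rule connects_mono[OF assms(2)]) blast
  ultimately have "connects V (insert {u, v} ?T)" by (rule connects_redundant[rotated])
  with ab P(1) that show thesis by blast
qed

section \<open>Digraph notions expressed by reachability along links\<close>

lemma strongly_connected_pair_iff:
  assumes "parcs G \<subseteq> pverts G \<times> pverts G"
  shows "strongly_connected (with_proj G) \<longleftrightarrow>
    pverts G \<noteq> {} \<and> (\<forall>u\<in>pverts G. \<forall>v\<in>pverts G. (u, v) \<in> (parcs G)\<^sup>*)"
proof -
  interpret pair_wf_digraph G using assms by unfold_locales auto
  show ?thesis by (auto simp: strongly_connected_def reachable_conv)
qed

text \<open>Connectedness is strong connectedness of the symmetric closure, and a symmetric digraph
  is its own closure.\<close>

lemma connected_pair_iff: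
  assumes "parcs G \<subseteq> pverts G \<times> pverts G" "sym (parcs G)"
  shows "Digraph_Component.connected (with_proj G) \<longleftrightarrow> strongly_connected (with_proj G)"
proof -
  have "parcs (mk_symmetric (with_proj G)) = parcs G"
    using assms(2) by (auto simp: mk_symmetric_def dest: symD)
  then have "mk_symmetric (with_proj G) = G"
    by (simp add: mk_symmetric_def)
  then show ?thesis by (simp add: Digraph_Component.connected_def)
qed

lemma graph_of_edges_simps [simp]:
  "pverts (graph_of_edges V T) = V" "parcs (graph_of_edges V T) = link_rel T"
  by (auto simp: graph_of_edges_def link_rel_def)

lemma link_rel_subset: "\<Union>T \<subseteq> V \<Longrightarrow> link_rel T \<subseteq> V \<times> V"
  by (auto simp: link_rel_def)

lemma strongly_connected_graph_of_edges_iff: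
  assumes "\<Union>T \<subseteq> V"
  shows "strongly_connected (with_proj (graph_of_edges V T)) \<longleftrightarrow> V \<noteq> {} \<and> connects V T"
  using link_rel_subset[OF assms] by (simp add: strongly_connected_pair_iff connects_def)

lemma connected_graph_of_edges_iff:
  assumes "\<Union>T \<subseteq> V"
  shows "Digraph_Component.connected (with_proj (graph_of_edges V T)) \<longleftrightarrow> V \<noteq> {} \<and> connects V T"
  using link_rel_subset[OF assms] strongly_connected_graph_of_edges_iff[OF assms]
  by (simp add: connected_pair_iff sym_link_rel)

lemma pcas_imp_rtrancl: "pcas u p v \<Longrightarrow> (u, v) \<in> (set p)\<^sup>*"
proof (induction p arbitrary: u)
  case (Cons e p)
  then have "(u, snd e) \<in> set (e # p)" by (cases e) auto
  moreover have "(snd e, v) \<in> (set (e # p))\<^sup>*"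
    using Cons rtrancl_mono[of "set p" "set (e # p)"] by auto
  ultimately show ?case by (rule converse_rtrancl_into_rtrancl)
qed simp

lemma pcas_arcs_in_pawalk_verts:
  "pcas u p v \<Longrightarrow> (x, y) \<in> set p \<Longrightarrow> x \<in> set (pawalk_verts u p) \<and> y \<in> set (pawalk_verts u p)"
proof (induction p arbitrary: u)
  case (Cons e p)
  have "z \<in> set (pawalk_verts z p)" if "pcas z p v" for z
    using that by (cases p) auto
  with Cons show ?case by fastforce
qed simp

text \<open>A later arc over the same undirected edge as the first one would contain the start
  vertex, which a path does not revisit.\<close>

lemma distinct_edges_of_path:
  "pcas u p v \<Longrightarrow> distinct (pawalk_verts u p) \<Longrightarrow> distinct (map (\<lambda>(u, v). {u, v}) p)"
proof (induction p arbitrary: u)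
  case (Cons e p)
  have "{fst e, snd e} \<noteq> {x, y}" if "(x, y) \<in> set p" for x y
    using pcas_arcs_in_pawalk_verts[of "snd e" p v x y] that Cons.prems by auto
  then have "(case e of (u, v) \<Rightarrow> {u, v}) \<notin> set (map (\<lambda>(u, v). {u, v}) p)"
    by (fastforce simp: case_prod_beta)
  with Cons.IH[of "snd e"] Cons.prems show ?case by simp
qed simp

lemma undirected_cycle_iff:
  "undirected_cycle G p \<longleftrightarrow> p \<noteq> [] \<and> set p \<subseteq> parcs G \<and>
     (\<exists>u\<in>pverts G. pcas u p u \<and> distinct (tl (pawalk_verts u p))) \<and>
     distinct (map (\<lambda>(u, v). {u, v}) p)"
  by (auto simp: undirected_cycle_def pre_digraph.cycle_def pre_digraph.awalk_def
      cas_with_proj_eq awalk_verts_with_proj_eq)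

text \<open>A cycle is a link together with a way back that avoids it; for a loop the way back is
  empty.\<close>

lemma undirected_cycle_graph_of_edges_iff:
  assumes "\<Union>T \<subseteq> V"
  shows "(\<exists>p. undirected_cycle (graph_of_edges V T) p) \<longleftrightarrow>
    (\<exists>a b. {a, b} \<in> T \<and> (b, a) \<in> (link_rel (T - {{a, b}}))\<^sup>*)"
proof
  assume "\<exists>p. undirected_cycle (graph_of_edges V T) p"
  then obtain p u where p: "p \<noteq> []" "set p \<subseteq> link_rel T" "pcas u p u"
    "distinct (map (\<lambda>(u, v). {u, v}) p)" by (auto simp: undirected_cycle_iff)
  then obtain a b q where q: "p = (a, b) # q" by (cases p) auto
  have "{a, b} \<notin> (\<lambda>(u, v). {u, v}) ` set q" using p(4) unfolding q by simp
  moreover have "{x, y} \<in> (\<lambda>(u, v). {u, v}) ` set q" if "(x, y) \<in> set q" for x y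
    using that by (rule rev_image_eqI) simp
  ultimately have "{x, y} \<noteq> {a, b}" if "(x, y) \<in> set q" for x y
    using that by metis
  moreover have "set q \<subseteq> link_rel T" using p(2) unfolding q by simp
  ultimately have "set q \<subseteq> link_rel (T - {{a, b}})"
    unfolding link_rel_def by blast
  moreover have "(b, a) \<in> (set q)\<^sup>*" using p(3) unfolding q by (auto intro: pcas_imp_rtrancl)
  ultimately have "(b, a) \<in> (link_rel (T - {{a, b}}))\<^sup>*" using rtrancl_mono by blast
  moreover have "{a, b} \<in> T" using p(2) unfolding q by (auto simp: link_rel_def)
  ultimately show "\<exists>a b. {a, b} \<in> T \<and> (b, a) \<in> (link_rel (T - {{a, b}}))\<^sup>*" by blast
next
  assume "\<exists>a b. {a, b} \<in> T \<and> (b, a) \<in> (link_rel (T - {{a, b}}))\<^sup>*"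
  then obtain a b where ab: "{a, b} \<in> T" "(b, a) \<in> (link_rel (T - {{a, b}}))\<^sup>*" by blast
  then have V: "a \<in> V" "b \<in> V" using assms by auto
  let ?H = "graph_of_edges V (T - {{a, b}})"
  have "\<Union>(T - {{a, b}}) \<subseteq> V" using assms by blast
  from link_rel_subset[OF this] interpret H: pair_wf_digraph ?H
    by unfold_locales auto
  have "b \<rightarrow>\<^sup>*\<^bsub>with_proj ?H\<^esub> a"
    using ab(2) V by (simp add: H.reachable_conv)
  \<comment> \<open>Taking a path instead of an arbitrary walk gives both the distinct vertices and
    the distinct undirected edges that a cycle requires.\<close>
  then obtain q where "H.apath b q a" by (auto simp: H.reachable_apath)
  then have q: "set q \<subseteq> link_rel (T - {{a, b}})" "pcas b q a" "distinct (pawalk_verts b q)"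
    by (auto simp: H.apath_def H.awalk_def)
  let ?p = "(a, b) # q"
  have "{a, b} \<notin> set (map (\<lambda>(u, v). {u, v}) q)" using q(1) by (auto simp: link_rel_def)
  with q distinct_edges_of_path[OF q(2,3)] ab(1) V have "undirected_cycle (graph_of_edges V T) ?p"
    by (auto simp: undirected_cycle_iff link_rel_def)
  then show "\<exists>p. undirected_cycle (graph_of_edges V T) p" ..
qed

text \<open>In a connecting set, a link closes a cycle exactly if the remaining links still connect.
  Being free of cycles thus becomes minimality under removal of a link.\<close>

lemma undirected_spanning_tree_iff:
  assumes "parcs G \<subseteq> pverts G \<times> pverts G"
  shows "undirected_spanning_tree G T \<longleftrightarrow>
    T \<subseteq> undirected_edges G \<and> pverts G \<noteq> {} \<and> connects (pverts G) T \<and>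
    (\<forall>f\<in>T. \<not> connects (pverts G) (T - {f}))"
proof (cases "T \<subseteq> undirected_edges G")
  case True
  then have V: "\<Union>T \<subseteq> pverts G" using assms by (fastforce simp: undirected_edges_def)
  have "(b, a) \<in> (link_rel (T - {{a, b}}))\<^sup>* \<longleftrightarrow> connects (pverts G) (T - {{a, b}})"
    if "{a, b} \<in> T" "connects (pverts G) T" for a b
  proof
    assume "(b, a) \<in> (link_rel (T - {{a, b}}))\<^sup>*"
    then have "(a, b) \<in> (link_rel (T - {{a, b}}))\<^sup>*" by (rule link_rel_rtrancl_sym)
    then show "connects (pverts G) (T - {{a, b}})"
      using that connects_redundant[of "pverts G" a b "T - {{a, b}}"] by (simp add: insert_absorb)
  next
    assume "connects (pverts G) (T - {{a, b}})"
    moreover have "a \<in> pverts G" "b \<in> pverts G" using that(1) V by auto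
    ultimately show "(b, a) \<in> (link_rel (T - {{a, b}}))\<^sup>*" by (simp add: connects_def)
  qed
  note redundant_iff = this
  have "(\<exists>a b. {a, b} \<in> T \<and> (b, a) \<in> (link_rel (T - {{a, b}}))\<^sup>*) \<longleftrightarrow>
      (\<exists>f\<in>T. connects (pverts G) (T - {f}))" if "connects (pverts G) T"
  proof
    assume "\<exists>a b. {a, b} \<in> T \<and> (b, a) \<in> (link_rel (T - {{a, b}}))\<^sup>*"
    then obtain a b where ab: "{a, b} \<in> T" "(b, a) \<in> (link_rel (T - {{a, b}}))\<^sup>*" by blast
    then show "\<exists>f\<in>T. connects (pverts G) (T - {f})" using redundant_iff[OF ab(1) that] by blast
  next
    assume "\<exists>f\<in>T. connects (pverts G) (T - {f})"
    then obtain f where f: "f \<in> T" "connects (pverts G) (T - {f})" by blast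
    with True obtain a b where "f = {a, b}" by (auto simp: undirected_edges_def)
    with f redundant_iff[of a b] that
    show "\<exists>a b. {a, b} \<in> T \<and> (b, a) \<in> (link_rel (T - {{a, b}}))\<^sup>*" by auto
  qed
  then show ?thesis
    unfolding undirected_spanning_tree_def connected_graph_of_edges_iff[OF V]
      undirected_cycle_graph_of_edges_iff[OF V]
    using True by auto
qed (simp add: undirected_spanning_tree_def)

section \<open>Optimal networks and minimum spanning trees\<close>

text \<open>By minimality, a spanning tree then contains no loop, so each of its links occupies two
  entries of the matrix.\<close>

lemma connects_remove_loop: "connects V T \<Longrightarrow> connects V (T - {{i}})"
  using connects_redundant[of V i i "T - {{i}}"] connects_mono[of V T "insert {i, i} (T - {{i}})"]
  by auto

lemma adjacency_mat_index [simp]: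
  "i < m \<Longrightarrow> j < m \<Longrightarrow> adjacency_mat m T $$ (i, j) = (if {i, j} \<in> T then 1 else 0)"
  by (simp add: adjacency_mat_def)

lemma adjacency_mat_carrier [simp]: "adjacency_mat m T \<in> carrier_mat m m"
  by (simp add: adjacency_mat_def)

lemma network_of_adjacency_mat:
  assumes "\<Union>T \<subseteq> {..<m}"
  shows "network_of (adjacency_mat m T) = graph_of_edges {..<m} T"
proof -
  have "dim_row (adjacency_mat m T) = m" "dim_col (adjacency_mat m T) = m"
    by (simp_all add: adjacency_mat_def)
  moreover have "u < m" "v < m" if "{u, v} \<in> T" for u v
    using that assms by auto
  ultimately show ?thesis
    by (auto simp: network_of_def graph_of_edges_def split: if_splits)
qed

locale weighted_network =
  fixes m :: nat and Gnet :: "nat pair_pre_digraph" and b :: "nat \<Rightarrow> nat \<Rightarrow> real"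
  assumes network: "sensor_network m Gnet b"
begin

abbreviation "links \<equiv> undirected_edges Gnet"

lemma pverts_eq: "pverts Gnet = {..<m}"
  using network by (simp add: sensor_network_def)

sublocale pair_pseudo_graph Gnet
  using network by (simp add: sensor_network_def)

lemma parcs_subset: "parcs Gnet \<subseteq> {..<m} \<times> {..<m}"
  using in_arcsD1 in_arcsD2 pverts_eq by auto

lemma cost_sym: "(i, j) \<in> parcs Gnet \<Longrightarrow> b i j = b j i"
  and cost_pos: "(i, j) \<in> parcs Gnet \<Longrightarrow> 0 < b i j"
  using network by (auto simp: sensor_network_def)

lemma in_links_iff: "{i, j} \<in> links \<longleftrightarrow> (i, j) \<in> parcs Gnet"
  using arcs_symmetric[of j i] by (auto simp: undirected_edges_def doubleton_eq_iff)

lemma link_rel_links: "link_rel links = parcs Gnet"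
  by (auto simp: link_rel_def in_links_iff)

lemma linksE:
  assumes "e \<in> links"
  obtains i j where "e = {i, j}" "(i, j) \<in> parcs Gnet" "i < m" "j < m"
  using assms parcs_subset by (auto simp: undirected_edges_def)

lemma Union_subset:
  assumes "T \<subseteq> links"
  shows "\<Union>T \<subseteq> {..<m}"
proof
  fix v assume "v \<in> \<Union>T"
  then obtain e where "e \<in> links" "v \<in> e" using assms by blast
  then show "v \<in> {..<m}" by (auto elim: linksE)
qed

lemma link_rel_subset_parcs: "T \<subseteq> links \<Longrightarrow> link_rel T \<subseteq> parcs Gnet"
  by (auto simp: link_rel_def in_links_iff[symmetric])

lemma finite_links: "finite links"
  using pair_finite_arcs by (simp add: undirected_edges_def)

lemma sensors_nonempty: "0 < m" and connects_links: "connects {..<m} links"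
proof -
  have "parcs Gnet \<subseteq> pverts Gnet \<times> pverts Gnet" using parcs_subset pverts_eq by simp
  moreover have "sym (parcs Gnet)" using arcs_symmetric by (auto intro: symI)
  moreover have "Digraph_Component.connected (with_proj Gnet)"
    using network by (simp add: sensor_network_def)
  ultimately show "0 < m" "connects {..<m} links"
    by (auto simp: connected_pair_iff strongly_connected_pair_iff pverts_eq connects_def
        link_rel_links)
qed

lemma weight_link: "(i, j) \<in> parcs Gnet \<Longrightarrow> b (Min {i, j}) (Max {i, j}) = b i j"
  using cost_sym[of i j] by (auto simp: min_def max_def)

lemma weight_pos:
  assumes "e \<in> links"
  shows "0 < b (Min e) (Max e)"
proof -
  obtain i j where "e = {i, j}" "(i, j) \<in> parcs Gnet" using assms by (rule linksE)
  then show ?thesis using weight_link[of i j] cost_pos[of i j] by simp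
qed

lemma edges_weight_strict_mono:
  assumes "T' \<subset> T" "T \<subseteq> links"
  shows "edges_weight b T' < edges_weight b T"
proof -
  obtain e where "e \<in> T - T'" using assms by blast
  then show ?thesis
    unfolding edges_weight_def
    using assms weight_pos finite_subset[OF assms(2) finite_links]
    by (intro sum_strict_mono2[of T T' e]) (auto intro: less_imp_le)
qed

lemma spanning_tree_iff:
  "undirected_spanning_tree Gnet T \<longleftrightarrow>
     T \<subseteq> links \<and> connects {..<m} T \<and> (\<forall>f\<in>T. \<not> connects {..<m} (T - {f}))"
  using undirected_spanning_tree_iff[of Gnet T] parcs_subset sensors_nonempty
  by (auto simp: pverts_eq)

section \<open>Feasible matrices as connecting sets of links\<close>

lemma feasible_adjacency_mat:
  assumes "T \<subseteq> links" "connects {..<m} T"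
  shows "feasible m Gnet (adjacency_mat m T)"
proof -
  have V: "\<Union>T \<subseteq> {..<m}" by (rule Union_subset[OF assms(1)])
  note [simp] = network_of_adjacency_mat[OF V]
  have "wf_digraph (with_proj (graph_of_edges {..<m} T))"
    using link_rel_subset[OF V] by (auto simp: wf_digraph_wp_iff pair_wf_digraph_def)
  then have "spanning (with_proj (network_of (adjacency_mat m T))) (with_proj Gnet)"
    using link_rel_subset_parcs[OF assms(1)] wf_digraph pverts_eq
    by (auto simp: spanning_def subgraph_def)
  moreover have "strongly_connected (with_proj (network_of (adjacency_mat m T)))"
    using assms(2) sensors_nonempty
    by (auto simp: strongly_connected_graph_of_edges_iff[OF V])
  ultimately show ?thesis
    by (auto simp: feasible_def insert_commute elements_mat_def adjacency_mat_def)
qed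

lemma feasibleE:
  assumes "feasible m Gnet W"
  obtains T where "T \<subseteq> links" "connects {..<m} T" "W = adjacency_mat m T"
proof
  let ?T = "{{i, j} | i j. i < m \<and> j < m \<and> W $$ (i, j) = 1}"
  have dim: "dim_row W = m" "dim_col W = m" and sym: "\<And>i j. i < m \<Longrightarrow> j < m \<Longrightarrow> W $$ (i, j) = W $$ (j, i)"
    and span: "spanning (with_proj (network_of W)) (with_proj Gnet)"
    and conn: "strongly_connected (with_proj (network_of W))"
    using assms by (auto simp: feasible_def)
  have "elements_mat W \<subseteq> {0, 1}" using assms by (simp add: feasible_def)
  then have entry: "W $$ (i, j) \<in> {0, 1}" if "i < m" "j < m" for i j
    using that dim elements_matI[of W m m i j "W $$ (i, j)"] by auto
  have arcs: "(i, j) \<in> parcs Gnet" if "i < m" "j < m" "W $$ (i, j) = 1" for i j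
    using span that dim by (auto simp: spanning_def subgraph_def network_of_def)
  then show T: "?T \<subseteq> links" by (auto simp: in_links_iff)
  \<comment> \<open>Here mutual sharing enters: \<open>{i, j}\<close> may be in the set because of
    the entry at (j, i).\<close>
  have in_T: "{i, j} \<in> ?T \<longleftrightarrow> W $$ (i, j) = 1" if "i < m" "j < m" for i j
    using that sym by (auto simp: doubleton_eq_iff)
  show W: "W = adjacency_mat m ?T"
  proof (rule eq_matI)
    fix i j assume "i < dim_row (adjacency_mat m ?T)" "j < dim_col (adjacency_mat m ?T)"
    then have "i < m" "j < m" by (simp_all add: adjacency_mat_def)
    then show "W $$ (i, j) = adjacency_mat m ?T $$ (i, j)"
      using entry[of i j] in_T[of i j] by (simp split del: if_split) auto
  qed (simp_all add: dim adjacency_mat_def)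
  show "connects {..<m} ?T"
    using conn strongly_connected_graph_of_edges_iff[OF Union_subset[OF T]]
      network_of_adjacency_mat[OF Union_subset[OF T]]
    by (subst (asm) W) auto
qed

text \<open>The restriction to \<open>links\<close> matters: a set that is not of the form
  \<open>{i, j}\<close> with i, j < m leaves no trace in the matrix.\<close>

lemma inj_on_adjacency_mat: "inj_on (adjacency_mat m) {T. T \<subseteq> links}"
proof (rule inj_onI, clarify)
  fix T T' assume *: "T \<subseteq> links" "T' \<subseteq> links" "adjacency_mat m T = adjacency_mat m T'"
  have "e \<in> T \<longleftrightarrow> e \<in> T'" if link: "e \<in> links" for e
  proof -
    obtain i j where e: "e = {i, j}" "i < m" "j < m" using link by (rule linksE)
    have "adjacency_mat m T $$ (i, j) = adjacency_mat m T' $$ (i, j)" using *(3) by simp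
    with e show ?thesis by (simp split: if_splits)
  qed
  with * show "T = T'" by blast
qed

section \<open>Network cost against weight of links\<close>

lemma network_cost_adjacency_mat:
  assumes "T \<subseteq> links"
  shows "network_cost m b (adjacency_mat m T) = (\<Sum>(i, j)\<in>link_rel T. b i j)"
proof -
  have "network_cost m b (adjacency_mat m T) =
      (\<Sum>i<m. \<Sum>j<m. if {i, j} \<in> T then b i j else 0)"
    unfolding network_cost_def by (intro sum.cong refl) auto
  also have "\<dots> = (\<Sum>(i, j)\<in>{..<m} \<times> {..<m}. if {i, j} \<in> T then b i j else 0)"
    by (simp add: sum.cartesian_product)
  also have "\<dots> = (\<Sum>(i, j)\<in>link_rel T. b i j)"
    using link_rel_subset[OF Union_subset[OF assms]]
    by (intro sum.mono_neutral_cong_right) (auto simp: link_rel_def)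
  finally show ?thesis .
qed

text \<open>This cannot be derived from the monotonicity of \<open>edges_weight\<close>, because in
  the presence of loops the cost is not twice the weight.\<close>

lemma network_cost_strict_mono:
  assumes "T' \<subset> T" "T \<subseteq> links"
  shows "network_cost m b (adjacency_mat m T') < network_cost m b (adjacency_mat m T)"
proof -
  obtain e where e: "e \<in> T - T'" using assms by blast
  with assms(2) have "e \<in> links" by blast
  then obtain i j where ij: "e = {i, j}" by (rule linksE)
  have "link_rel T \<subseteq> parcs Gnet" by (rule link_rel_subset_parcs[OF assms(2)])
  moreover have "finite (link_rel T)"
    using finite_subset[OF \<open>link_rel T \<subseteq> parcs Gnet\<close> pair_finite_arcs] .
  moreover have "(i, j) \<in> link_rel T - link_rel T'" using e ij by (simp add: link_rel_def)
  moreover have "link_rel T' \<subseteq> link_rel T" using assms by (auto simp: link_rel_def)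
  ultimately have "(\<Sum>(i, j)\<in>link_rel T'. b i j) < (\<Sum>(i, j)\<in>link_rel T. b i j)"
    using cost_pos
    by (intro sum_strict_mono2[of _ _ "(i, j)"]) (auto simp: subset_iff intro!: less_imp_le)
  with assms show ?thesis by (simp add: network_cost_adjacency_mat)
qed

lemma network_cost_spanning_tree:
  assumes "undirected_spanning_tree Gnet T"
  shows "network_cost m b (adjacency_mat m T) = 2 * edges_weight b T"
proof -
  have T: "T \<subseteq> links" using assms by (simp add: spanning_tree_iff)
  have noloop: "{i} \<notin> T" for i
    using assms connects_remove_loop[of "{..<m}" T i] by (auto simp: spanning_tree_iff)
  let ?edge = "\<lambda>(i, j). {i, j}"
  have "network_cost m b (adjacency_mat m T) = (\<Sum>p\<in>link_rel T. case p of (i, j) \<Rightarrow> b i j)"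
    by (rule network_cost_adjacency_mat[OF T])
  \<comment> \<open>Arcs are grouped by their undirected edge; without loops each group consists of
    two opposite arcs.\<close>
  also have "\<dots> = (\<Sum>e\<in>T. \<Sum>p | p \<in> link_rel T \<and> ?edge p = e. case p of (i, j) \<Rightarrow> b i j)"
  proof (rule sum.group[symmetric])
    show "finite (link_rel T)"
      using finite_subset[OF link_rel_subset_parcs[OF T] pair_finite_arcs] .
    show "finite T" using finite_subset[OF T finite_links] .
  qed (auto simp: link_rel_def)
  also have "\<dots> = (\<Sum>e\<in>T. 2 * b (Min e) (Max e))"
  proof (rule sum.cong[OF refl])
    fix e assume e: "e \<in> T"
    with T have "e \<in> links" by blast
    then obtain i j where ij: "e = {i, j}" "(i, j) \<in> parcs Gnet" by (rule linksE)
    have "{p. p \<in> link_rel T \<and> ?edge p = e} = {(i, j), (j, i)}"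
    proof -
      have "{p. p \<in> link_rel T \<and> ?edge p = e} = {p. ?edge p = e}"
        using e by (auto simp: link_rel_def)
      also have "\<dots> = {(i, j), (j, i)}"
      proof (rule Set.set_eqI)
        show "p \<in> {p. ?edge p = e} \<longleftrightarrow> p \<in> {(i, j), (j, i)}" for p
          unfolding ij(1) by (cases p) (simp add: doubleton_eq_iff)
      qed
      finally show ?thesis .
    qed
    moreover have "i \<noteq> j" using noloop[of i] e ij(1) by auto
    ultimately have "(\<Sum>p | p \<in> link_rel T \<and> ?edge p = e. case p of (i, j) \<Rightarrow> b i j) = b i j + b j i"
      by simp
    then show "(\<Sum>p | p \<in> link_rel T \<and> ?edge p = e. case p of (i, j) \<Rightarrow> b i j) = 2 * b (Min e) (Max e)"
      using cost_sym[OF ij(2)] weight_link[OF ij(2)] ij(1) by simp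
  qed
  finally show ?thesis by (simp add: edges_weight_def sum_distrib_left)
qed

lemma contains_spanning_tree:
  assumes "T \<subseteq> links" "connects {..<m} T"
  obtains T' where "T' \<subseteq> T" "undirected_spanning_tree Gnet T'"
proof -
  have "finite T" using finite_subset[OF assms(1) finite_links] .
  from ex_minimal_subset[of T "connects {..<m}", OF this assms(2)]
  obtain T' where "T' \<subseteq> T" "connects {..<m} T'" "\<forall>f\<in>T'. \<not> connects {..<m} (T' - {f})"
    by blast
  with assms(1) that show thesis by (simp add: spanning_tree_iff)
qed

lemma optimal_adjacency_mat_iff:
  assumes "T \<subseteq> links"
  shows "optimal_network m Gnet b (adjacency_mat m T) \<longleftrightarrow> min_spanning_tree Gnet b T"
proof
  let ?cost = "\<lambda>T. network_cost m b (adjacency_mat m T)"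
  assume opt: "optimal_network m Gnet b (adjacency_mat m T)"
  then have le: "?cost T \<le> ?cost T'" if "T' \<subseteq> links" "connects {..<m} T'" for T'
    using feasible_adjacency_mat[OF that]
    by (auto simp: optimal_network_def is_arg_min_linorder)
  \<comment> \<open>Optimality only provides some connecting set with the same matrix; injectivity
    identifies it with \<open>T\<close>.\<close>
  obtain S where "S \<subseteq> links" "connects {..<m} S" "adjacency_mat m T = adjacency_mat m S"
    using opt feasibleE by (auto simp: optimal_network_def is_arg_min_def)
  then have T: "connects {..<m} T" using inj_on_adjacency_mat assms by (auto dest: inj_onD)
  then obtain T' where T': "T' \<subseteq> T" "undirected_spanning_tree Gnet T'"
    using contains_spanning_tree assms by blast
  have "T' = T"
  proof (rule ccontr)
    assume "T' \<noteq> T"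
    then have "?cost T' < ?cost T" using T' assms by (intro network_cost_strict_mono) auto
    moreover have "?cost T \<le> ?cost T'" using T'(2) by (intro le) (auto simp: spanning_tree_iff)
    ultimately show False by simp
  qed
  then have tree: "undirected_spanning_tree Gnet T" using T' by simp
  moreover have "edges_weight b T \<le> edges_weight b T''" if "undirected_spanning_tree Gnet T''" for T''
    using le[of T''] that tree by (auto simp: network_cost_spanning_tree spanning_tree_iff)
  ultimately show "min_spanning_tree Gnet b T"
    by (auto simp: min_spanning_tree_def is_arg_min_linorder)
next
  let ?cost = "\<lambda>T. network_cost m b (adjacency_mat m T)"
  assume mst: "min_spanning_tree Gnet b T"
  then have tree: "undirected_spanning_tree Gnet T"
    by (simp add: min_spanning_tree_def is_arg_min_def)
  have "?cost T \<le> network_cost m b W" if W: "feasible m Gnet W" for W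
  proof -
    obtain S where S: "S \<subseteq> links" "connects {..<m} S" "W = adjacency_mat m S"
      using W by (rule feasibleE)
    then obtain T' where T': "T' \<subseteq> S" "undirected_spanning_tree Gnet T'"
      using contains_spanning_tree by blast
    have "?cost T = 2 * edges_weight b T" by (rule network_cost_spanning_tree[OF tree])
    also have "\<dots> \<le> 2 * edges_weight b T'"
      using mst T'(2) by (auto simp: min_spanning_tree_def is_arg_min_linorder)
    also have "\<dots> = ?cost T'" by (simp add: network_cost_spanning_tree[OF T'(2)])
    also have "\<dots> \<le> ?cost S"
      using network_cost_strict_mono[of T' S] T'(1) S(1)
      by (cases "T' = S") (auto simp: psubset_eq)
    finally show ?thesis using S(3) by simp
  qed
  then show "optimal_network m Gnet b (adjacency_mat m T)"
    using tree feasible_adjacency_mat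
    by (auto simp: optimal_network_def is_arg_min_linorder spanning_tree_iff)
qed

lemma bij_betw_min_spanning_trees:
  "bij_betw (adjacency_mat m) {T. min_spanning_tree Gnet b T} {W. optimal_network m Gnet b W}"
proof (rule bij_betw_imageI)
  have sub: "T \<subseteq> links" if "min_spanning_tree Gnet b T" for T
    using that by (auto simp: min_spanning_tree_def is_arg_min_def spanning_tree_iff)
  then show "inj_on (adjacency_mat m) {T. min_spanning_tree Gnet b T}"
    using inj_on_adjacency_mat by (auto intro: inj_on_subset)
  show "adjacency_mat m ` {T. min_spanning_tree Gnet b T} = {W. optimal_network m Gnet b W}"
  proof (intro equalityI subsetI)
    fix W assume W: "W \<in> {W. optimal_network m Gnet b W}"
    then have "feasible m Gnet W" by (simp add: optimal_network_def is_arg_min_def)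
    then obtain T where "T \<subseteq> links" "W = adjacency_mat m T" by (rule feasibleE)
    with W show "W \<in> adjacency_mat m ` {T. min_spanning_tree Gnet b T}"
      using optimal_adjacency_mat_iff by auto
  qed (use sub optimal_adjacency_mat_iff in auto)
qed

section \<open>Lightest connecting sets and the cut property\<close>

definition lightest :: "nat set set \<Rightarrow> bool" where
  "lightest T \<longleftrightarrow> T \<subseteq> links \<and> connects {..<m} T \<and>
     (\<forall>T'\<subseteq>links. connects {..<m} T' \<longrightarrow> edges_weight b T \<le> edges_weight b T')"

lemma ex_lightest: "\<exists>T. lightest T"
proof -
  let ?C = "{T. T \<subseteq> links \<and> connects {..<m} T}"
  have fin: "finite (edges_weight b ` ?C)" using finite_links by simp
  have "edges_weight b ` ?C \<noteq> {}" using connects_links by blast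
  from Min_in[OF fin this] obtain T where T: "T \<in> ?C"
    "edges_weight b T = Min (edges_weight b ` ?C)" by auto
  then have "edges_weight b T \<le> edges_weight b T'" if "T' \<in> ?C" for T'
    using fin that by simp
  with T show ?thesis by (auto simp: lightest_def)
qed

lemma lightest_imp_min_spanning_tree:
  assumes "lightest T"
  shows "min_spanning_tree Gnet b T"
proof -
  have "\<not> connects {..<m} (T - {f})" if "f \<in> T" for f
  proof
    assume "connects {..<m} (T - {f})"
    moreover have T: "T \<subseteq> links" using assms by (simp add: lightest_def)
    ultimately have "edges_weight b T \<le> edges_weight b (T - {f})"
      using assms unfolding lightest_def by blast
    moreover have "edges_weight b (T - {f}) < edges_weight b T"
      using that T by (intro edges_weight_strict_mono) auto
    ultimately show False by simp
  qed
  with assms show ?thesis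
    by (auto simp: min_spanning_tree_def is_arg_min_linorder spanning_tree_iff lightest_def)
qed

text \<open>Needed when the algorithm stops: the selected links lie in a lightest set, and once they
  connect, positive costs leave no room for further links.\<close>

lemma lightest_subset:
  assumes "lightest T" "F \<subseteq> T" "connects {..<m} F"
  shows "F = T"
proof (rule ccontr)
  assume "F \<noteq> T"
  then have "edges_weight b F < edges_weight b T"
    using assms by (intro edges_weight_strict_mono) (auto simp: lightest_def)
  moreover have "edges_weight b T \<le> edges_weight b F"
    using assms unfolding lightest_def by blast
  ultimately show False by simp
qed

text \<open>The cut property: a link of \<open>T\<close> that crosses the cut is traded for the
  cheapest crossing link, which does not increase the weight.\<close>

lemma lightest_exchange:
  assumes "lightest T" "F \<subseteq> T" "\<Union>F \<subseteq> S"
    and uv: "(u, v) \<in> parcs Gnet" "u \<in> S" "v \<notin> S"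
    and min: "\<And>i j. (i, j) \<in> parcs Gnet \<Longrightarrow> i \<in> S \<Longrightarrow> j \<notin> S \<Longrightarrow> b u v \<le> b i j"
  obtains T' where "lightest T'" "insert {u, v} F \<subseteq> T'"
proof -
  have T: "T \<subseteq> links" "connects {..<m} T" using assms(1) by (auto simp: lightest_def)
  then have fin: "finite T" using finite_subset finite_links by blast
  have "u \<in> {..<m}" "v \<in> {..<m}" using uv(1) parcs_subset by auto
  from connects_exchange[OF fin T(2) this uv(2,3)]
  obtain i j where ij: "{i, j} \<in> T" "i \<in> S" "j \<notin> S"
    and conn: "connects {..<m} (insert {u, v} (T - {{i, j}}))" by blast
  let ?T = "insert {u, v} (T - {{i, j}})"
  have arc: "(i, j) \<in> parcs Gnet" using ij(1) T(1) by (auto simp: in_links_iff[symmetric])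
  \<comment> \<open>Only an inequality, since the new link may already belong to the rest of
    \<open>T\<close>.\<close>
  have "edges_weight b ?T \<le> b (Min {u, v}) (Max {u, v}) + edges_weight b (T - {{i, j}})"
    unfolding edges_weight_def using fin weight_pos[of "{u, v}"] uv(1)
    by (cases "{u, v} \<in> T - {{i, j}}") (auto simp: insert_absorb in_links_iff)
  also have "b (Min {u, v}) (Max {u, v}) \<le> b (Min {i, j}) (Max {i, j})"
    using min[OF arc ij(2,3)] weight_link[OF arc] weight_link[OF uv(1)] by simp
  also have "b (Min {i, j}) (Max {i, j}) + edges_weight b (T - {{i, j}}) = edges_weight b T"
    unfolding edges_weight_def using fin ij(1) by (simp add: sum.remove[of T "{i, j}"])
  finally have "edges_weight b ?T \<le> edges_weight b T" by simp
  moreover have "?T \<subseteq> links" using T(1) uv(1) by (auto simp: in_links_iff)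
  ultimately have "lightest ?T"
    using conn assms(1) unfolding lightest_def by (meson order_trans)
  \<comment> \<open>The removed link leaves \<open>S\<close>, while the selected links stay inside
    \<open>S\<close>.\<close>
  moreover have "{i, j} \<notin> F" using assms(3) ij(3) by auto
  then have "insert {u, v} F \<subseteq> ?T" using assms(2) by auto
  ultimately show thesis by (rule that)
qed

end

section \<open>Running times of programs\<close>

text \<open>Total correctness with an upper time bound. Since \<open>exec\<close> is deterministic,
  the halting run it asserts is the only one.\<close>

definition runs :: "com \<Rightarrow> memory \<Rightarrow> nat \<Rightarrow> (memory \<Rightarrow> bool) \<Rightarrow> bool" where
  "runs p s t Q \<longleftrightarrow> (\<exists>t' s'. exec p s t' s' \<and> t' \<le> t \<and> Q s')"

lemma runs_mono:
  assumes "runs p s t Q" "t \<le> u" "\<And>s'. Q s' \<Longrightarrow> R s'"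
  shows "runs p s u R"
  using assms unfolding runs_def by (meson order_trans)

lemma runs_Seq:
  assumes "runs p s t P" "\<And>s'. P s' \<Longrightarrow> runs q s' u Q"
  shows "runs (Seq p q) s (t + u) Q"
proof -
  obtain t1 s1 where 1: "exec p s t1 s1" "t1 \<le> t" "P s1"
    using assms(1) unfolding runs_def by blast
  obtain t2 s2 where 2: "exec q s1 t2 s2" "t2 \<le> u" "Q s2"
    using assms(2)[OF 1(3)] unfolding runs_def by blast
  have "exec (Seq p q) s (t1 + t2) s2" by (rule exec_Seq[OF 1(1) 2(1)])
  with 1(2) 2(2,3) show ?thesis unfolding runs_def by (meson add_mono)
qed

text \<open>Code without loops is treated by evaluation: simplification computes its final memory
  with \<open>result\<close> and a time bound with \<open>max_time\<close>, so only loops require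
  invariants.\<close>

primrec loop_free :: "com \<Rightarrow> bool" where
  "loop_free Skip = True"
| "loop_free (SetNVar x e) = True"
| "loop_free (SetNArr x i e) = True"
| "loop_free (SetRArr x i j r) = True"
| "loop_free (Seq p q) = (loop_free p \<and> loop_free q)"
| "loop_free (Cond c p q) = (loop_free p \<and> loop_free q)"
| "loop_free (While c p) = False"

text \<open>The values of \<open>result\<close> and \<open>max_time\<close> on loops are irrelevant.\<close>

primrec result :: "com \<Rightarrow> memory \<Rightarrow> memory" where
  "result Skip s = s"
| "result (SetNVar x e) s = s\<lparr>nvar := (nvar s)(x := nval e s)\<rparr>"
| "result (SetNArr x i e) s = s\<lparr>narr := (narr s)(x := (narr s x)(nval i s := nval e s))\<rparr>"
| "result (SetRArr x i j r) s =
     s\<lparr>rarr := (rarr s)(x := (rarr s x)(nval i s :=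
       (rarr s x (nval i s))(nval j s := rval r s)))\<rparr>"
| "result (Seq p q) s = result q (result p s)"
| "result (Cond c p q) s = (if bval c s then result p s else result q s)"
| "result (While c p) s = s"

primrec max_time :: "com \<Rightarrow> nat" where
  "max_time Skip = 1"
| "max_time (SetNVar x e) = ncost e + 1"
| "max_time (SetNArr x i e) = ncost i + ncost e + 1"
| "max_time (SetRArr x i j r) = ncost i + ncost j + rcost r + 1"
| "max_time (Seq p q) = max_time p + max_time q"
| "max_time (Cond c p q) = bcost c + max (max_time p) (max_time q) + 1"
| "max_time (While c p) = 0"

lemma exec_loop_free: "loop_free p \<Longrightarrow> \<exists>t \<le> max_time p. exec p s t (result p s)"
proof (induction p arbitrary: s)
  case Skip
  show ?case using exec_Skip[of s] by auto
next
  case (SetNVar x e)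
  show ?case using exec_SetNVar[of x e s] by auto
next
  case (SetNArr x i e)
  show ?case using exec_SetNArr[of x i e s] by auto
next
  case (SetRArr x i j r)
  show ?case using exec_SetRArr[of x i j r s] by auto
next
  case (Seq p q)
  then obtain t u where "t \<le> max_time p" "exec p s t (result p s)"
    "u \<le> max_time q" "exec q (result p s) u (result q (result p s))" by fastforce
  then show ?case by (intro exI[of _ "t + u"]) (auto intro: exec_Seq)
next
  case (Cond c p q)
  show ?case
  proof (cases "bval c s")
    case True
    obtain t where "t \<le> max_time p" "exec p s t (result p s)" using Cond by fastforce
    with True show ?thesis
      by (intro exI[of _ "bcost c + t + 1"]) (auto dest: exec_CondTrue)
  next
    case False
    obtain t where "t \<le> max_time q" "exec q s t (result q s)" using Cond by fastforce
    with False show ?thesis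
      by (intro exI[of _ "bcost c + t + 1"]) (auto dest: exec_CondFalse)
  qed
qed simp

lemma runs_loop_free: "loop_free p \<Longrightarrow> max_time p \<le> t \<Longrightarrow> Q (result p s) \<Longrightarrow> runs p s t Q"
  using exec_loop_free[of p s] unfolding runs_def by (meson order_trans)

definition for_loop :: "vname \<Rightarrow> nat \<Rightarrow> com \<Rightarrow> com" where
  "for_loop x a p =
     Seq (SetNVar x (NConst a))
       (While (NLess (NVar x) (NVar ''m''))
         (Seq p (SetNVar x (NAdd (NVar x) (NConst 1)))))"

text \<open>Each round adds 8 to the body: 4 for the test and 4 for the increment. The summand 6 is
  2 for the initial assignment and 4 for the last, failing test. Counting m rounds covers every
  start value.\<close>

lemma runs_for_loop:
  assumes counter: "\<And>k s. I k s \<Longrightarrow> nvar s x = k \<and> nvar s ''m'' = m"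
    and init: "I a (s\<lparr>nvar := (nvar s)(x := a)\<rparr>)" "a \<le> m"
    and body: "\<And>k s. k < m \<Longrightarrow> I k s \<Longrightarrow>
      runs p s t (\<lambda>s'. I (Suc k) (s'\<lparr>nvar := (nvar s')(x := Suc (nvar s' x))\<rparr>))"
  shows "runs (for_loop x a p) s (m * (t + 8) + 6) (I m)"
proof -
  let ?c = "NLess (NVar x) (NVar ''m'')"
  let ?inc = "SetNVar x (NAdd (NVar x) (NConst 1))"
  have loop: "runs (While ?c (Seq p ?inc)) s ((m - k) * (t + 8) + 4) (I m)"
    if "I k s" "k \<le> m" for k s
    using that
  proof (induction "m - k" arbitrary: k s)
    case 0
    then have "I m s" "\<not> bval ?c s" using counter[of k s] by auto
    with exec_WhileFalse[OF this(2), of "Seq p ?inc"] show ?case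
      unfolding runs_def by (intro exI[of _ "bcost ?c + 1"] exI[of _ s]) simp
  next
    case (Suc d)
    then have k: "k < m" by simp
    let ?J = "\<lambda>s'. I (Suc k) (s'\<lparr>nvar := (nvar s')(x := Suc (nvar s' x))\<rparr>)"
    have "runs (Seq p ?inc) s (t + 4) (I (Suc k))"
    proof (rule runs_Seq[OF body[OF k Suc.prems(1)]])
      show "runs ?inc s' 4 (I (Suc k))" if "?J s'" for s'
        using that by (intro runs_loop_free) simp_all
    qed
    then obtain t1 s1 where 1: "exec (Seq p ?inc) s t1 s1" "t1 \<le> t + 4" "I (Suc k) s1"
      unfolding runs_def by blast
    have "d = m - Suc k" "Suc k \<le> m" using Suc.hyps(2) by simp_all
    from Suc.hyps(1)[OF this(1) 1(3) this(2)]
    obtain t2 s2 where 2: "exec (While ?c (Seq p ?inc)) s1 t2 s2"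
      "t2 \<le> (m - Suc k) * (t + 8) + 4" "I m s2"
      unfolding runs_def by blast
    have "bval ?c s" using k counter[OF Suc.prems(1)] by simp
    from exec_WhileTrue[OF this 1(1) 2(1)]
    have "exec (While ?c (Seq p ?inc)) s (bcost ?c + t1 + t2 + 1) s2" .
    moreover have "m - k = Suc (m - Suc k)" using k by simp
    then have "bcost ?c + t1 + t2 + 1 \<le> (m - k) * (t + 8) + 4"
      using 1(2) 2(2) by simp
    ultimately show ?case using 2(3) unfolding runs_def by blast
  qed
  have "runs (for_loop x a p) s (2 + ((m - a) * (t + 8) + 4)) (I m)"
    unfolding for_loop_def
  proof (rule runs_Seq)
    show "runs (SetNVar x (NConst a)) s 2 (I a)"
      using init(1) by (intro runs_loop_free) simp_all
  qed (rule loop[OF _ init(2)])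
  then show ?thesis
    by (rule runs_mono) (simp_all add: mult_le_mono1)
qed

section \<open>Prim's algorithm\<close>

text \<open>The initial memory is arbitrary, so the output array must be erased. Parent 0 is already
  correct for the start, when sensor 0 is the only visited one.\<close>

definition clear :: com where
  "clear = for_loop ''i'' 0
     (Seq (Seq (SetNArr ''visited'' (NVar ''i'') (NConst 0))
               (SetNArr ''parent'' (NVar ''i'') (NConst 0)))
       (for_loop ''j'' 0 (SetRArr ''W'' (NVar ''i'') (NVar ''j'') (RConst 0))))"

definition unvisited :: bexp where
  "unvisited = NLess (NArr ''visited'' (NVar ''j'')) (NConst 1)"

text \<open>The key is looked up in the input through the parent. The value 0 plays the role of
  infinity: no link to a visited sensor is known.\<close>

definition key :: "nexp \<Rightarrow> rexp" where
  "key v = RArr ''A'' (NArr ''parent'' v) v"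

text \<open>The value \<open>m\<close> of \<open>best\<close> means that no candidate has been
  found. The negated conjunction encodes "none yet, or a smaller key"; reading the key of
  \<open>best = m\<close> is harmless, as evaluation is total.\<close>

definition find_nearest :: com where
  "find_nearest = Seq (SetNVar ''best'' (NVar ''m''))
     (for_loop ''j'' 0
       (Cond (BAnd unvisited (BAnd (RLess (RConst 0) (key (NVar ''j'')))
           (BNot (BAnd (NLess (NVar ''best'') (NVar ''m''))
             (BNot (RLess (key (NVar ''j'')) (key (NVar ''best''))))))))
         (SetNVar ''best'' (NVar ''j''))
         Skip))"

definition attach :: com where
  "attach =
     Seq (SetRArr ''W'' (NArr ''parent'' (NVar ''best'')) (NVar ''best'') (RConst 1))
    (Seq (SetRArr ''W'' (NVar ''best'') (NArr ''parent'' (NVar ''best'')) (RConst 1))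
         (SetNArr ''visited'' (NVar ''best'') (NConst 1)))"

definition relax :: com where
  "relax = for_loop ''j'' 0
     (Cond (BAnd unvisited (BAnd (RLess (RConst 0) (RArr ''A'' (NVar ''best'') (NVar ''j'')))
         (BNot (BAnd (RLess (RConst 0) (key (NVar ''j'')))
           (BNot (RLess (RArr ''A'' (NVar ''best'') (NVar ''j'')) (key (NVar ''j''))))))))
       (SetNArr ''parent'' (NVar ''j'') (NVar ''best''))
       Skip)"

text \<open>The main loop starts at 1 because sensor 0 is visited beforehand; its counter is the
  number of visited sensors.\<close>

definition prim :: com where
  "prim = Seq clear (Seq (SetNArr ''visited'' (NConst 0) (NConst 1))
     (for_loop ''k'' 1 (Seq find_nearest (Seq attach relax))))"

context weighted_network
begin

section \<open>Invariants of the algorithm, stated for sets of sensors and links\<close>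

definition w :: "nat \<Rightarrow> nat \<Rightarrow> real" where
  "w i j = (if (i, j) \<in> parcs Gnet then b i j else 0)"

lemma w_pos_iff: "0 < w i j \<longleftrightarrow> (i, j) \<in> parcs Gnet"
  by (simp add: w_def cost_pos)

text \<open>\<open>S\<close> is the set of visited sensors and \<open>F\<close> the set of selected links.\<close>

definition partial_tree :: "nat set \<Rightarrow> nat set set \<Rightarrow> bool" where
  "partial_tree S F \<longleftrightarrow> S \<subseteq> {..<m} \<and> 0 \<in> S \<and> \<Union>F \<subseteq> S \<and>
     (\<exists>T. lightest T \<and> F \<subseteq> T) \<and> (\<forall>i\<in>S. (0, i) \<in> (link_rel F)\<^sup>*)"

text \<open>If no visited sensor has a link to \<open>j\<close>, then \<open>p j\<close> is any
  visited sensor and \<open>w (p j) j = 0\<close>. Hence a positive key says exactly that some link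
  joins \<open>j\<close> to \<open>S\<close>.\<close>

definition nearest :: "nat set \<Rightarrow> (nat \<Rightarrow> nat) \<Rightarrow> bool" where
  "nearest S p \<longleftrightarrow> (\<forall>j<m. j \<notin> S \<longrightarrow> p j \<in> S \<and>
     (\<forall>i\<in>S. (i, j) \<in> parcs Gnet \<longrightarrow> (p j, j) \<in> parcs Gnet \<and> b (p j) j \<le> b i j))"

text \<open>The parameter \<open>n\<close> bounds the sensors scanned so far; \<open>n = m\<close>
  gives the overall minimum.\<close>

definition closest :: "nat set \<Rightarrow> (nat \<Rightarrow> nat) \<Rightarrow> nat \<Rightarrow> nat \<Rightarrow> bool" where
  "closest S p n v \<longleftrightarrow> v < m \<and> v \<notin> S \<and> 0 < w (p v) v \<and>
     (\<forall>j<n. j \<notin> S \<longrightarrow> 0 < w (p j) j \<longrightarrow> w (p v) v \<le> w (p j) j)"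

lemma partial_tree_extend:
  assumes "partial_tree S F" "nearest S p" "closest S p m v"
  shows "partial_tree (insert v S) (insert {p v, v} F)"
proof -
  have v: "v < m" "v \<notin> S" "(p v, v) \<in> parcs Gnet"
    using assms(3) by (auto simp: closest_def w_pos_iff)
  then have pv: "p v \<in> S" using assms(2) by (simp add: nearest_def)
  \<comment> \<open>Two minimisations combine: over the visited end for fixed \<open>j\<close>, by
    \<open>nearest\<close>, and over the unvisited end, by \<open>closest\<close>.\<close>
  have min: "b (p v) v \<le> b i j" if "(i, j) \<in> parcs Gnet" "i \<in> S" "j \<notin> S" for i j
  proof -
    have "j < m" using that(1) parcs_subset by auto
    then have j: "(p j, j) \<in> parcs Gnet" "b (p j) j \<le> b i j"
      using assms(2) that unfolding nearest_def by blast+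
    then have "w (p v) v \<le> w (p j) j"
      using assms(3) \<open>j < m\<close> that(3) unfolding closest_def w_pos_iff by blast
    with j v(3) show ?thesis by (simp add: w_def)
  qed
  obtain T where T: "lightest T" "F \<subseteq> T" and F: "\<Union>F \<subseteq> S" "S \<subseteq> {..<m}" "0 \<in> S"
    and reach: "\<And>i. i \<in> S \<Longrightarrow> (0, i) \<in> (link_rel F)\<^sup>*"
    using assms(1) unfolding partial_tree_def by blast
  obtain T' where "lightest T'" "insert {p v, v} F \<subseteq> T'"
    by (rule lightest_exchange[OF T F(1) v(3) pv v(2) min])
  moreover have reach': "(0, i) \<in> (link_rel (insert {p v, v} F))\<^sup>*" if "i \<in> S" for i
    using reach[OF that] by (rule link_rel_rtrancl_mono) blast
  have "(0, v) \<in> (link_rel (insert {p v, v} F))\<^sup>*"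
    by (rule rtrancl_into_rtrancl[OF reach'[OF pv]]) (simp add: link_rel_def)
  ultimately show ?thesis
    using F pv v(1) reach' unfolding partial_tree_def by auto
qed

text \<open>A path of available links from sensor 0 to an unvisited sensor must leave
  \<open>S\<close>. This is where connectedness of the network keeps the search from
  failing.\<close>

lemma ex_closer:
  assumes "partial_tree S F" "nearest S p" "S \<noteq> {..<m}"
  shows "\<exists>j<m. j \<notin> S \<and> 0 < w (p j) j"
proof -
  obtain x where x: "x < m" "x \<notin> S" and 0: "0 \<in> S"
    using assms(1,3) unfolding partial_tree_def by blast
  have "(0, x) \<in> (parcs Gnet)\<^sup>*"
    using connects_links sensors_nonempty x(1) by (simp add: connects_def link_rel_links)
  from rtrancl_crosses[OF this 0 x(2)]
  obtain i j where ij: "(i, j) \<in> parcs Gnet" "i \<in> S" "j \<notin> S" by blast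
  then have "j < m" using parcs_subset by auto
  with ij assms(2) show ?thesis unfolding nearest_def w_pos_iff by blast
qed

text \<open>The condition mirrors the test of the program: the new sensor wins if its link is
  strictly cheaper or if no link was known.\<close>

definition relaxed :: "nat set \<Rightarrow> (nat \<Rightarrow> nat) \<Rightarrow> nat \<Rightarrow> nat \<Rightarrow> nat" where
  "relaxed S p v j =
     (if j \<notin> S \<and> 0 < w v j \<and> \<not> (0 < w (p j) j \<and> \<not> w v j < w (p j) j) then v else p j)"

text \<open>For a sensor that stays unvisited, \<open>v\<close> is the only new candidate, so one
  comparison with the old parent suffices.\<close>

lemma nearest_relaxed:
  assumes "nearest S p"
  shows "nearest (insert v S) (relaxed (insert v S) p v)"
  unfolding nearest_def
proof (intro allI impI conjI)
  fix j assume j: "j < m" "j \<notin> insert v S"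
  then have p: "p j \<in> S" "\<forall>i\<in>S. (i, j) \<in> parcs Gnet \<longrightarrow> (p j, j) \<in> parcs Gnet \<and> b (p j) j \<le> b i j"
    using assms unfolding nearest_def by blast+
  then show "relaxed (insert v S) p v j \<in> insert v S" by (simp add: relaxed_def)
  show "\<forall>i\<in>insert v S. (i, j) \<in> parcs Gnet \<longrightarrow>
      (relaxed (insert v S) p v j, j) \<in> parcs Gnet \<and> b (relaxed (insert v S) p v j) j \<le> b i j"
    using p(2) j(2) by (auto simp: relaxed_def w_pos_iff) (auto simp: w_def)
qed

lemma partial_tree_complete:
  assumes "partial_tree {..<m} F"
  shows "optimal_network m Gnet b (adjacency_mat m F)"
proof -
  have reach: "(0, i) \<in> (link_rel F)\<^sup>*" if "i < m" for i
    using assms that by (simp add: partial_tree_def)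
  have "connects {..<m} F"
    unfolding connects_def using reach link_rel_rtrancl_sym rtrancl_trans
    by (metis lessThan_iff)
  moreover obtain T where "lightest T" "F \<subseteq> T" using assms by (auto simp: partial_tree_def)
  ultimately have "lightest F" using lightest_subset by blast
  then show ?thesis
    using lightest_imp_min_spanning_tree optimal_adjacency_mat_iff by (auto simp: lightest_def)
qed

section \<open>Memory contents and running times\<close>

definition input :: "memory \<Rightarrow> bool" where
  "input s \<longleftrightarrow> nvar s ''m'' = m \<and> (\<forall>i<m. \<forall>j<m. rarr s ''A'' i j = w i j)"

definition represents :: "nat set \<Rightarrow> nat set set \<Rightarrow> (nat \<Rightarrow> nat) \<Rightarrow> memory \<Rightarrow> bool" where
  "represents S F p s \<longleftrightarrow> input s \<and>
     (\<forall>i<m. narr s ''visited'' i = 0 \<longleftrightarrow> i \<notin> S) \<and>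
     (\<forall>i<m. narr s ''parent'' i = p i) \<and>
     (\<forall>i<m. \<forall>j<m. rarr s ''W'' i j = (if {i, j} \<in> F then 1 else 0))"

lemma input_nvar [simp]:
  "x \<noteq> ''m'' \<Longrightarrow> input (s\<lparr>nvar := (nvar s)(x := n)\<rparr>) = input s"
  by (simp add: input_def)

lemma represents_nvar [simp]:
  "x \<noteq> ''m'' \<Longrightarrow> represents S F p (s\<lparr>nvar := (nvar s)(x := n)\<rparr>) = represents S F p s"
  by (simp add: represents_def)

lemma represents_size: "represents S F p s \<Longrightarrow> nvar s ''m'' = m"
  by (simp add: represents_def input_def)

lemma runs_clear:
  assumes "input s"
  shows "runs clear s (m * (12 * m + 20) + 6)
    (\<lambda>s'. input s' \<and> (\<forall>i<m. narr s' ''visited'' i = 0 \<and> narr s' ''parent'' i = 0 \<and>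
       (\<forall>j<m. rarr s' ''W'' i j = 0)))"
proof -
  let ?zero = "\<lambda>s i. narr s ''visited'' i = 0 \<and> narr s ''parent'' i = 0"
  let ?I = "\<lambda>k s. nvar s ''i'' = k \<and> input s \<and> (\<forall>i<k. ?zero s i \<and> (\<forall>j<m. rarr s ''W'' i j = 0))"
  let ?J = "\<lambda>k l s. nvar s ''j'' = l \<and> ?I k s \<and> ?zero s k \<and> (\<forall>j<l. rarr s ''W'' k j = 0)"
  have "runs clear s (m * ((6 + (m * (4 + 8) + 6)) + 8) + 6) (?I m)"
    unfolding clear_def
  proof (rule runs_for_loop[where I = ?I])
    fix k s assume k: "k < m" "?I k s"
    show "runs (Seq (Seq (SetNArr ''visited'' (NVar ''i'') (NConst 0))
          (SetNArr ''parent'' (NVar ''i'') (NConst 0)))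
        (for_loop ''j'' 0 (SetRArr ''W'' (NVar ''i'') (NVar ''j'') (RConst 0))))
      s (6 + (m * (4 + 8) + 6)) (\<lambda>s'. ?I (Suc k) (s'\<lparr>nvar := (nvar s')(''i'' := Suc (nvar s' ''i''))\<rparr>))"
    proof (rule runs_Seq)
      show "runs (Seq (SetNArr ''visited'' (NVar ''i'') (NConst 0))
          (SetNArr ''parent'' (NVar ''i'') (NConst 0))) s 6 (\<lambda>s'. ?I k s' \<and> ?zero s' k)"
        using k by (intro runs_loop_free) (auto simp: input_def)
    next
      fix s assume s: "?I k s \<and> ?zero s k"
      have "runs (for_loop ''j'' 0 (SetRArr ''W'' (NVar ''i'') (NVar ''j'') (RConst 0))) s
        (m * (4 + 8) + 6) (?J k m)"
      proof (rule runs_for_loop[where I = "?J k"])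
        fix l s assume "l < m" "?J k l s"
        then show "runs (SetRArr ''W'' (NVar ''i'') (NVar ''j'') (RConst 0)) s 4
          (\<lambda>s'. ?J k (Suc l) (s'\<lparr>nvar := (nvar s')(''j'' := Suc (nvar s' ''j''))\<rparr>))"
          by (intro runs_loop_free) (auto simp: input_def less_Suc_eq)
      qed (use s in \<open>auto simp: input_def\<close>)
      then show "runs (for_loop ''j'' 0 (SetRArr ''W'' (NVar ''i'') (NVar ''j'') (RConst 0))) s
        (m * (4 + 8) + 6) (\<lambda>s'. ?I (Suc k) (s'\<lparr>nvar := (nvar s')(''i'' := Suc (nvar s' ''i''))\<rparr>))"
        by (rule runs_mono) (auto simp: less_Suc_eq)
    qed
  qed (use assms in \<open>auto simp: input_def\<close>)
  then show ?thesis by (rule runs_mono) (auto simp: algebra_simps)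
qed

lemma runs_find_nearest:
  assumes "represents S F p s" "nvar s ''k'' = k" "partial_tree S F" "nearest S p" "S \<noteq> {..<m}"
  shows "runs find_nearest s (38 * m + 8)
    (\<lambda>s'. represents S F p s' \<and> nvar s' ''k'' = k \<and> closest S p m (nvar s' ''best''))"
proof -
  \<comment> \<open>The contents of \<open>A\<close> are known only for indices below
    \<open>m\<close>, so parents must be shown to stay in range.\<close>
  have p: "p j < m" if "j < m" "j \<notin> S" for j
    using that assms(3,4) by (auto simp: nearest_def partial_tree_def)
  let ?I = "\<lambda>n s. nvar s ''j'' = n \<and> represents S F p s \<and> nvar s ''k'' = k \<and>
    (nvar s ''best'' = m \<and> (\<forall>j<n. j \<notin> S \<longrightarrow> \<not> 0 < w (p j) j) \<or> closest S p n (nvar s ''best''))"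
  have "runs find_nearest s (2 + (m * (30 + 8) + 6)) (?I m)"
    unfolding find_nearest_def
  proof (rule runs_Seq)
    show "runs (SetNVar ''best'' (NVar ''m'')) s 2
      (\<lambda>s'. represents S F p s' \<and> nvar s' ''k'' = k \<and> nvar s' ''best'' = m)"
      using assms(1,2) represents_size by (intro runs_loop_free) auto
  next
    fix s assume s: "represents S F p s \<and> nvar s ''k'' = k \<and> nvar s ''best'' = m"
    let ?p = "Cond (BAnd unvisited (BAnd (RLess (RConst 0) (key (NVar ''j'')))
           (BNot (BAnd (NLess (NVar ''best'') (NVar ''m''))
             (BNot (RLess (key (NVar ''j'')) (key (NVar ''best''))))))))
         (SetNVar ''best'' (NVar ''j''))
         Skip"
    show "runs (for_loop ''j'' 0 ?p) s (m * (30 + 8) + 6) (?I m)"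
    proof (rule runs_for_loop[where I = ?I])
      fix n s assume n: "n < m" and I: "?I n s"
      have m: "nvar s ''m'' = m" and r: "represents S F p s" using I represents_size by auto
      have vis: "bval unvisited s \<longleftrightarrow> n \<notin> S"
        using r n I by (simp add: unvisited_def represents_def)
      have key: "rval (key (NVar x)) s = w (p (nvar s x)) (nvar s x)"
        if "nvar s x < m" "nvar s x \<notin> S" for x
        using r that p[OF that] by (simp add: key_def represents_def input_def)
      show "runs ?p s 30 (\<lambda>s'. ?I (Suc n) (s'\<lparr>nvar := (nvar s')(''j'' := Suc (nvar s' ''j''))\<rparr>))"
      proof (rule runs_loop_free)
        show "max_time ?p \<le> 30" by (simp add: unvisited_def key_def)
        show "?I (Suc n) ((result ?p s)\<lparr>nvar := (nvar (result ?p s))(''j'' := Suc (nvar (result ?p s) ''j''))\<rparr>)"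
        proof (cases "closest S p n (nvar s ''best'')")
          case True
          then have "nvar s ''best'' < m" "nvar s ''best'' \<notin> S" by (auto simp: closest_def)
          note best = key[OF this]
          show ?thesis
            using True I n m vis best key[of "''j''"]
            by (cases "n \<in> S") (auto simp: closest_def less_Suc_eq)
        next
          case False
          then show ?thesis
            using I n m vis key[of "''j''"]
            by (cases "n \<in> S") (auto simp: closest_def less_Suc_eq)
        qed
      qed simp
    qed (use s represents_size in auto)
  qed
  then show ?thesis
  proof (rule runs_mono)
    \<comment> \<open>The alternative \<open>best = m\<close> of the invariant is excluded by a
      crossing link.\<close>
    fix s' assume I: "?I m s'"
    with ex_closer[OF assms(3-5)] show "represents S F p s' \<and> nvar s' ''k'' = k \<and>
      closest S p m (nvar s' ''best'')" by auto
  qed simp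
qed

lemma runs_attach:
  assumes "represents S F p s" "nvar s ''k'' = k" "v < m" "p v < m" "nvar s ''best'' = v"
  shows "runs attach s 13 (\<lambda>s'. represents (insert v S) (insert {p v, v} F) p s' \<and>
    nvar s' ''k'' = k \<and> nvar s' ''best'' = v)"
proof (rule runs_loop_free)
  have "narr s ''parent'' v = p v" using assms by (simp add: represents_def)
  then show "represents (insert v S) (insert {p v, v} F) p (result attach s) \<and>
      nvar (result attach s) ''k'' = k \<and> nvar (result attach s) ''best'' = v"
    using assms by (auto simp: attach_def represents_def input_def doubleton_eq_iff)
qed (simp_all add: attach_def)

lemma runs_relax:
  assumes "represents S F p s" "nvar s ''k'' = k" "v < m" "\<And>j. j < m \<Longrightarrow> j \<notin> S \<Longrightarrow> p j < m"
    "nvar s ''best'' = v"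
  shows "runs relax s (40 * m + 6) (\<lambda>s'. represents S F (relaxed S p v) s' \<and> nvar s' ''k'' = k)"
proof -
  \<comment> \<open>The parent array in the middle of the scan. Updating in place is safe, because
    the new parent of \<open>j\<close> depends on no other entry of the array.\<close>
  let ?q = "\<lambda>n j. if j < n then relaxed S p v j else p j"
  let ?I = "\<lambda>n s. nvar s ''j'' = n \<and> represents S F (?q n) s \<and> nvar s ''k'' = k \<and> nvar s ''best'' = v"
  let ?p = "Cond (BAnd unvisited (BAnd (RLess (RConst 0) (RArr ''A'' (NVar ''best'') (NVar ''j'')))
         (BNot (BAnd (RLess (RConst 0) (key (NVar ''j'')))
           (BNot (RLess (RArr ''A'' (NVar ''best'') (NVar ''j'')) (key (NVar ''j''))))))))
       (SetNArr ''parent'' (NVar ''j'') (NVar ''best''))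
       Skip"
  have "runs relax s (m * (32 + 8) + 6) (?I m)"
    unfolding relax_def
  proof (rule runs_for_loop[where I = ?I])
    fix n s assume n: "n < m" and I: "?I n s"
    then have r: "represents S F (?q n) s" by simp
    have vis: "bval unvisited s \<longleftrightarrow> n \<notin> S"
      using r n I by (simp add: unvisited_def represents_def)
    have key: "rval (key (NVar ''j'')) s = w (p n) n" if "n \<notin> S"
      using r I n assms(4)[OF n that] by (simp add: key_def represents_def input_def)
    have A: "rarr s ''A'' v n = w v n" using r n assms(3) by (simp add: represents_def input_def)
    have test: "bval (BAnd unvisited (BAnd (RLess (RConst 0) (RArr ''A'' (NVar ''best'') (NVar ''j'')))
         (BNot (BAnd (RLess (RConst 0) (key (NVar ''j'')))
           (BNot (RLess (RArr ''A'' (NVar ''best'') (NVar ''j'')) (key (NVar ''j'')))))))) s \<longleftrightarrow>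
       n \<notin> S \<and> 0 < w v n \<and> \<not> (0 < w (p n) n \<and> \<not> w v n < w (p n) n)"
      using vis key A I by auto
    show "runs ?p s 32 (\<lambda>s'. ?I (Suc n) (s'\<lparr>nvar := (nvar s')(''j'' := Suc (nvar s' ''j''))\<rparr>))"
    proof (rule runs_loop_free)
      show "max_time ?p \<le> 32" by (simp add: unvisited_def key_def)
      show "?I (Suc n) ((result ?p s)\<lparr>nvar := (nvar (result ?p s))(''j'' := Suc (nvar (result ?p s) ''j''))\<rparr>)"
        using I unfolding result.simps test
        by (auto simp: represents_def input_def relaxed_def less_Suc_eq)
    qed simp
  qed (use assms represents_size in auto)
  then show ?thesis
    by (rule runs_mono) (auto simp: represents_def)
qed

lemma runs_prim:
  assumes "input s"
  shows "runs prim s (90 * m\<^sup>2 + 55 * m + 15) (\<lambda>s'. optimal_network m Gnet b (output_mat m s'))"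
proof -
  \<comment> \<open>Tying the counter to \<open>card S\<close> ensures an unvisited sensor in every
    round and forces all sensors to be visited at the end.\<close>
  let ?I = "\<lambda>k s. nvar s ''k'' = k \<and> (\<exists>S F p. card S = k \<and> partial_tree S F \<and> nearest S p \<and>
    represents S F p s)"
  have "runs prim s (m * (12 * m + 20) + 6 + (3 + (m * ((38 * m + 8 + (13 + (40 * m + 6))) + 8) + 6))) (?I m)"
    unfolding prim_def
  proof (rule runs_Seq[OF runs_clear[OF assms]], rule runs_Seq)
    fix s assume s: "input s \<and> (\<forall>i<m. narr s ''visited'' i = 0 \<and> narr s ''parent'' i = 0 \<and>
      (\<forall>j<m. rarr s ''W'' i j = 0))"
    then show "runs (SetNArr ''visited'' (NConst 0) (NConst 1)) s 3 (represents {0} {} (\<lambda>_. 0))"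
      by (intro runs_loop_free) (auto simp: represents_def input_def)
  next
    fix s assume s: "represents {0} {} (\<lambda>_. 0) s"
    have start: "partial_tree {0} {}" "nearest {0} (\<lambda>_. 0)"
      using sensors_nonempty ex_lightest by (auto simp: partial_tree_def nearest_def)
    show "runs (for_loop ''k'' 1 (Seq find_nearest (Seq attach relax))) s
      (m * ((38 * m + 8 + (13 + (40 * m + 6))) + 8) + 6) (?I m)"
    proof (rule runs_for_loop[where I = ?I])
      show "?I 1 (s\<lparr>nvar := (nvar s)(''k'' := 1)\<rparr>)"
        using s start by (auto intro!: exI[of _ "{0}"])
      show "1 \<le> m" using sensors_nonempty by simp
    next
      fix k s assume k: "k < m" "?I k s"
      then obtain S F p where S: "card S = k" "partial_tree S F" "nearest S p" "represents S F p s"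
        by blast
      have pS: "p j < m" if "j < m" "j \<notin> S" for j
        using that S(2,3) by (auto simp: nearest_def partial_tree_def)
      have fin: "finite S" using S(2) finite_subset by (auto simp: partial_tree_def)
      have "S \<noteq> {..<m}" using k(1) S(1) by auto
      note find = runs_find_nearest[OF S(4) conjunct1[OF k(2)] S(2,3) this]
      show "runs (Seq find_nearest (Seq attach relax)) s (38 * m + 8 + (13 + (40 * m + 6)))
        (\<lambda>s'. ?I (Suc k) (s'\<lparr>nvar := (nvar s')(''k'' := Suc (nvar s' ''k''))\<rparr>))"
      proof (rule runs_Seq[OF find])
        fix s assume s: "represents S F p s \<and> nvar s ''k'' = k \<and> closest S p m (nvar s ''best'')"
        define v where "v = nvar s ''best''"
        have v: "closest S p m v" "v < m" "v \<notin> S" using s by (auto simp: v_def closest_def)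
        let ?S = "insert v S" and ?F = "insert {p v, v} F"
        have att: "runs attach s 13 (\<lambda>s'. represents ?S ?F p s' \<and> nvar s' ''k'' = k \<and> nvar s' ''best'' = v)"
          using s v pS by (intro runs_attach) (auto simp: v_def)
        show "runs (Seq attach relax) s (13 + (40 * m + 6))
          (\<lambda>s'. ?I (Suc k) (s'\<lparr>nvar := (nvar s')(''k'' := Suc (nvar s' ''k''))\<rparr>))"
        proof (rule runs_Seq[OF att])
          fix s assume s: "represents ?S ?F p s \<and> nvar s ''k'' = k \<and> nvar s ''best'' = v"
          then have "runs relax s (40 * m + 6)
            (\<lambda>s'. represents ?S ?F (relaxed ?S p v) s' \<and> nvar s' ''k'' = k)"
            using v(2) pS by (intro runs_relax) auto
          then show "runs relax s (40 * m + 6)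
            (\<lambda>s'. ?I (Suc k) (s'\<lparr>nvar := (nvar s')(''k'' := Suc (nvar s' ''k''))\<rparr>))"
          proof (rule runs_mono)
            fix s' assume s': "represents ?S ?F (relaxed ?S p v) s' \<and> nvar s' ''k'' = k"
            have "card ?S = Suc k" using fin v(3) S(1) by simp
            moreover have "partial_tree ?S ?F" by (rule partial_tree_extend[OF S(2,3) v(1)])
            moreover have "nearest ?S (relaxed ?S p v)" by (rule nearest_relaxed[OF S(3)])
            ultimately show "?I (Suc k) (s'\<lparr>nvar := (nvar s')(''k'' := Suc (nvar s' ''k''))\<rparr>)"
              using s' by (auto intro!: exI[of _ ?S])
          qed simp
        qed
      qed
    qed (use represents_size in auto)
  qed
  then show ?thesis
  proof (rule runs_mono)
    fix s' assume "?I m s'"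
    then obtain S F p where S: "card S = m" "partial_tree S F" "represents S F p s'" by blast
    then have "S = {..<m}" by (intro card_subset_eq) (auto simp: partial_tree_def)
    moreover have "output_mat m s' = adjacency_mat m F"
      using S(3) by (auto simp: output_mat_def adjacency_mat_def represents_def intro!: eq_matI)
    ultimately show "optimal_network m Gnet b (output_mat m s')"
      using S(2) partial_tree_complete by simp
  qed (simp add: power2_eq_square algebra_simps)
qed

end

text \<open>For m \<ge> 1 each power of m is at most its square, so 160 = 90 + 55 + 15 serves as the
  constant.\<close>

lemma quadratic_bigo: "(\<lambda>m. real (90 * m\<^sup>2 + 55 * m + 15)) \<in> O(\<lambda>m. real m ^ 2)"
proof (rule bigoI[where c = 160])
  show "\<forall>\<^sub>F m in at_top. norm (real (90 * m\<^sup>2 + 55 * m + 15)) \<le> 160 * norm (real m ^ 2)"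
    using eventually_ge_at_top[of 1]
  proof eventually_elim
    case (elim m)
    then have "1 \<le> real m" by simp
    then have "real m \<le> real m ^ 2" "1 \<le> real m ^ 2"
      using self_le_power[of "real m" 2] by simp_all
    then have "55 * real m + 15 \<le> 70 * real m ^ 2" by linarith
    then show ?case by simp
  qed
qed

theorem mainTheorem2:
  shows "(\<forall>m Gnet b. sensor_network m Gnet b \<longrightarrow>
            (\<forall>T. undirected_spanning_tree Gnet T \<longrightarrow>
               feasible m Gnet (adjacency_mat m T) \<and>
               network_cost m b (adjacency_mat m T) = 2 * edges_weight b T) \<and>
            bij_betw (adjacency_mat m)
              {T. min_spanning_tree Gnet b T} {W. optimal_network m Gnet b W})
       \<and> (\<exists>p (time :: nat \<Rightarrow> nat).
            (\<lambda>m. real (time m)) \<in> O(\<lambda>m. real m ^ 2) \<and>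
            (\<forall>m Gnet b s. sensor_network m Gnet b \<longrightarrow>
               holds_input m (weighted_adjacency_mat m Gnet b) s \<longrightarrow>
               (\<exists>t s'. exec p s t s' \<and> t \<le> time m \<and>
                  optimal_network m Gnet b (output_mat m s'))))"
proof (intro conjI allI impI)
  fix m Gnet b assume "sensor_network m Gnet b"
  then interpret weighted_network m Gnet b by unfold_locales
  show "bij_betw (adjacency_mat m) {T. min_spanning_tree Gnet b T} {W. optimal_network m Gnet b W}"
    by (rule bij_betw_min_spanning_trees)
  fix T assume T: "undirected_spanning_tree Gnet T"
  then show "feasible m Gnet (adjacency_mat m T)"
    by (intro feasible_adjacency_mat) (simp_all add: spanning_tree_iff)
  show "network_cost m b (adjacency_mat m T) = 2 * edges_weight b T"
    by (rule network_cost_spanning_tree[OF T])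
next
  show "\<exists>p (time :: nat \<Rightarrow> nat).
    (\<lambda>m. real (time m)) \<in> O(\<lambda>m. real m ^ 2) \<and>
    (\<forall>m Gnet b s. sensor_network m Gnet b \<longrightarrow>
       holds_input m (weighted_adjacency_mat m Gnet b) s \<longrightarrow>
       (\<exists>t s'. exec p s t s' \<and> t \<le> time m \<and> optimal_network m Gnet b (output_mat m s')))"
  \<comment> \<open>One program and one bound serve all sizes and networks; the polynomial is the
    sum of the costs of clearing and of the rounds.\<close>
  proof (intro exI[of _ prim] exI[of _ "\<lambda>m. 90 * m\<^sup>2 + 55 * m + 15"] conjI allI impI)
    fix m Gnet b s
    assume "sensor_network m Gnet b" and input: "holds_input m (weighted_adjacency_mat m Gnet b) s"
    then interpret weighted_network m Gnet b by unfold_locales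
    have "input s"
      using input by (simp add: holds_input_def input_def weighted_adjacency_mat_def w_def)
    from runs_prim[OF this]
    show "\<exists>t s'. exec prim s t s' \<and> t \<le> 90 * m\<^sup>2 + 55 * m + 15 \<and>
      optimal_network m Gnet b (output_mat m s')"
      unfolding runs_def .
  qed (rule quadratic_bigo)
qed

end
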